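(* Let $\Gamma$ be a finite simple graph and let $S\subset V_\Gamma$ be an anti-connected subset. Then the right-angled Artin group $A(\overline{CO}(\Gamma,S))$ embeds in $A(\Gamma)$, i.e. there is an injective homomorphism $A(\overline{CO}(\Gamma,S))\to A(\Gamma)$.
   Context: All graphs are finite and simple. For a graph $\Gamma$ with vertex set $V_\Gamma$ and edge set $E_\Gamma$, the right-angled Artin group with defining graph $\Gamma$ is $$A(\Gamma)=\langle V_\Gamma \ ;\ vwv^{-1}w^{-1}=1 \text{ for all } \{v,w\}\in E_\Gamma\rangle.$$ For $W\subset V_\Gamma$, $\Gamma_W$ denotes the induced subgraph of $\Gamma$ on $W$. The complement graph $\overline{\Gamma}$ has the same vertices as $\Gamma$, and two distinct vertices are adjacent in $\overline{\Gamma}$ if and only if they are not adjacent in $\Gamma$. For $S\subset V_\Gamma$, the contraction $CO(\Gamma,S)$ of $\Gamma$ relative to $S$ is the graph consisting of the induced subgraph $\Gamma_{V_\Gamma\setminus S}$ together with one new vertex $v_S$, where $v_S$ is adjacent to $w\in V_\Gamma\setminus S$ if and only if $w$ is adjacent in $\Gamma$ to some vertex of $S$. The co-contraction is $\overline{CO}(\Gamma,S)=\overline{CO(\overline{\Gamma},S)}$. A set $S\subset V_\Gamma$ is anti-connected if $\overline{\Gamma}_S$, the subgraph of $\overline{\Gamma}$ induced on $S$, is connected; connected graphs are understood to be nonempty, so $S\neq\emptyset$. *)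

theory Defs
  imports "HOL-Algebra.Coset" "Graph_Theory.Graph_Theory"
begin

text \<open>
  Finite simple graphs are taken from the AFP entry \<open>Graph_Theory\<close>: the locale \<^locale>\<open>pair_graph\<close>
  describes records of a finite vertex set and a symmetric, irreflexive set of ordered pairs of
  vertices, an edge \<open>{v, w}\<close> being represented by the two arcs \<open>(v, w)\<close> and \<open>(w, v)\<close>.
\<close>

section \<open>Groups given by presentations\<close>

text \<open>
  The letter \<open>(x, True)\<close> stands for the generator \<open>x\<close> and \<open>(x, False)\<close> for its formal inverse.
\<close>

type_synonym 'a word = "('a \<times> bool) list"

definition words :: "'a set \<Rightarrow> 'a word set" where
  "words X = lists (X \<times> UNIV)"

inductive presentation_eq :: "'a set \<Rightarrow> 'a word set \<Rightarrow> 'a word \<Rightarrow> 'a word \<Rightarrow> bool"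
  for X :: "'a set" and R :: "'a word set" where
  refl: "u \<in> words X \<Longrightarrow> presentation_eq X R u u"
| sym: "presentation_eq X R u v \<Longrightarrow> presentation_eq X R v u"
| trans: "presentation_eq X R u v \<Longrightarrow> presentation_eq X R v w \<Longrightarrow> presentation_eq X R u w"
| cancel: "u \<in> words X \<Longrightarrow> v \<in> words X \<Longrightarrow> x \<in> X \<Longrightarrow>
    presentation_eq X R (u @ [(x, b), (x, \<not> b)] @ v) (u @ v)"
| relator: "u \<in> words X \<Longrightarrow> v \<in> words X \<Longrightarrow> r \<in> R \<Longrightarrow>
    presentation_eq X R (u @ r @ v) (u @ v)"

definition presentation_rel :: "'a set \<Rightarrow> 'a word set \<Rightarrow> 'a word rel" where
  "presentation_rel X R = {(u, v). presentation_eq X R u v}"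

definition presented_group :: "'a set \<Rightarrow> 'a word set \<Rightarrow> 'a word set monoid" where
  "presented_group X R =
    \<lparr>carrier = words X // presentation_rel X R,
     monoid.mult = (\<lambda>A B. \<Union>u\<in>A. \<Union>v\<in>B. presentation_rel X R `` {u @ v}),
     one = presentation_rel X R `` {[]}\<rparr>"

section \<open>Right-angled Artin groups\<close>

definition raag :: "'a pair_pre_digraph \<Rightarrow> 'a word set monoid" where
  "raag G = presented_group (pverts G)
     {[(v, True), (w, True), (v, False), (w, False)] | v w. (v, w) \<in> parcs G}"

section \<open>Complements, contractions and co-contractions\<close>

definition complement_graph :: "'a pair_pre_digraph \<Rightarrow> 'a pair_pre_digraph" where
  "complement_graph G =
    \<lparr>pverts = pverts G,
     parcs = {(u, v). u \<in> pverts G \<and> v \<in> pverts G \<and> u \<noteq> v \<and> (u, v) \<notin> parcs G}\<rparr>"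

text \<open>
  The new vertex of a contraction is \<^term>\<open>None\<close>; an old vertex \<open>w\<close> becomes \<open>Some w\<close>.
\<close>

definition contraction :: "'a pair_pre_digraph \<Rightarrow> 'a set \<Rightarrow> 'a option pair_pre_digraph" where
  "contraction G S =
    \<lparr>pverts = insert None (Some ` (pverts G - S)),
     parcs = {(Some u, Some v) | u v. u \<in> pverts G - S \<and> v \<in> pverts G - S \<and> (u, v) \<in> parcs G}
       \<union> {(None, Some w) | w. w \<in> pverts G - S \<and> (\<exists>s\<in>S. (s, w) \<in> parcs G)}
       \<union> {(Some w, None) | w. w \<in> pverts G - S \<and> (\<exists>s\<in>S. (w, s) \<in> parcs G)}\<rparr>"

definition co_contraction :: "'a pair_pre_digraph \<Rightarrow> 'a set \<Rightarrow> 'a option pair_pre_digraph" where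
  "co_contraction G S = complement_graph (contraction (complement_graph G) S)"

text \<open>
  The graph-theoretic notion of connectedness used here includes nonemptiness of the vertex set.
\<close>

definition anti_connected :: "'a pair_pre_digraph \<Rightarrow> 'a set \<Rightarrow> bool" where
  "anti_connected G S \<longleftrightarrow> Digraph_Component.connected (with_proj (complement_graph G) \<restriction> S)"

section \<open>Well-definedness\<close>

lemma pair_graph_complement: "pair_graph G \<Longrightarrow> pair_graph (complement_graph G)"
proof -
  assume "pair_graph G"
  then interpret pair_graph G .
  have "finite (pverts G \<times> pverts G)" by (simp add: pair_finite_verts)
  then have "finite (parcs (complement_graph G))"
    by (rule finite_subset[rotated]) (auto simp: complement_graph_def)
  moreover have "(v, u) \<in> parcs G" if "(u, v) \<in> parcs G" for u v
    using that pair_sym_arcs by (auto simp: symmetric_def sym_def)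
  ultimately show ?thesis
    by unfold_locales (auto simp: complement_graph_def symmetric_def pair_finite_verts intro!: symI)
qed

lemma pair_graph_contraction:
  assumes "pair_graph G"
  shows "pair_graph (contraction G S)"
proof -
  interpret pair_graph G by fact
  have *: "parcs (contraction G S) \<subseteq> pverts (contraction G S) \<times> pverts (contraction G S)"
    by (auto simp: contraction_def)
  have fin: "finite (pverts (contraction G S))"
    by (simp add: contraction_def pair_finite_verts)
  have "finite (parcs (contraction G S))"
    using * fin by (meson finite_SigmaI finite_subset)
  moreover have "sym (parcs (contraction G S))"
    using pair_sym_arcs by (auto simp: contraction_def symmetric_def sym_def)
  moreover have "fst e \<noteq> snd e" if "e \<in> parcs (contraction G S)" for e
    using that pair_no_loops by (fastforce simp: contraction_def)
  ultimately show ?thesis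
    using fin * by unfold_locales (auto simp: symmetric_def)
qed

lemma pair_graph_co_contraction: "pair_graph G \<Longrightarrow> pair_graph (co_contraction G S)"
  by (simp add: co_contraction_def pair_graph_complement pair_graph_contraction)

lemma presentation_eq_words:
  assumes "presentation_eq X R u v" and "R \<subseteq> words X"
  shows "u \<in> words X \<and> v \<in> words X"
  using assms by induction (auto simp: words_def)

lemma equiv_presentation_rel:
  assumes "R \<subseteq> words X"
  shows "equiv (words X) (presentation_rel X R)"
proof (rule equivI)
  show "presentation_rel X R \<subseteq> words X \<times> words X"
    using presentation_eq_words[OF _ assms] by (auto simp: presentation_rel_def)
  show "refl_on (words X) (presentation_rel X R)"
    by (auto simp: presentation_rel_def refl_on_def intro: presentation_eq.refl)
  show "sym (presentation_rel X R)"
    unfolding sym_def presentation_rel_def by (blast intro: presentation_eq.sym)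
  show "trans (presentation_rel X R)"
    unfolding trans_def presentation_rel_def by (blast intro: presentation_eq.trans)
qed

lemma presentation_eq_append_left:
  assumes "presentation_eq X R u v" and "w \<in> words X"
  shows "presentation_eq X R (w @ u) (w @ v)"
  using assms
proof induction
  case (cancel u v x b)
  then show ?case using presentation_eq.cancel[of "w @ u" X v x R b] by (simp add: words_def)
next
  case (relator u v r)
  then show ?case using presentation_eq.relator[of "w @ u" X v r R] by (simp add: words_def)
next
  case (refl u)
  then show ?case by (intro presentation_eq.refl) (simp add: words_def)
qed (blast intro: presentation_eq.sym, blast intro: presentation_eq.trans)

lemma presentation_eq_append_right:
  assumes "presentation_eq X R u v" and "w \<in> words X"
  shows "presentation_eq X R (u @ w) (v @ w)"
  using assms
proof induction
  case (cancel u v x b)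
  then show ?case using presentation_eq.cancel[of u X "v @ w" x R b] by (simp add: words_def)
next
  case (relator u v r)
  then show ?case using presentation_eq.relator[of u X "v @ w" r R] by (simp add: words_def)
next
  case (refl u)
  then show ?case by (intro presentation_eq.refl) (simp add: words_def)
qed (blast intro: presentation_eq.sym, blast intro: presentation_eq.trans)

lemma presented_group_mult_class:
  assumes R: "R \<subseteq> words X" and u: "u \<in> words X" and v: "v \<in> words X"
  shows "presentation_rel X R `` {u} \<otimes>\<^bsub>presented_group X R\<^esub> presentation_rel X R `` {v}
    = presentation_rel X R `` {u @ v}"
proof -
  have "presentation_rel X R `` {a @ b} = presentation_rel X R `` {u @ v}"
    if "presentation_eq X R u a" "presentation_eq X R v b" for a b
  proof -
    have "presentation_eq X R (u @ v) (a @ v)"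
      using that v by (auto intro: presentation_eq_append_right)
    moreover have "presentation_eq X R (a @ v) (a @ b)"
      using that presentation_eq_words[OF that(1) R] by (auto intro: presentation_eq_append_left)
    ultimately have "(u @ v, a @ b) \<in> presentation_rel X R"
      unfolding presentation_rel_def by (blast intro: presentation_eq.trans)
    then show ?thesis using equiv_class_eq[OF equiv_presentation_rel[OF R]] by metis
  qed
  moreover have "presentation_eq X R u u" "presentation_eq X R v v"
    using u v by (auto intro: presentation_eq.refl)
  ultimately have "(\<Union>a\<in>presentation_rel X R `` {u}. \<Union>b\<in>presentation_rel X R `` {v}.
      presentation_rel X R `` {a @ b}) = presentation_rel X R `` {u @ v}"
    unfolding presentation_rel_def by blast
  then show ?thesis by (simp add: presented_group_def)
qed

lemma presentation_eq_inverse: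
  "u \<in> words X \<Longrightarrow> presentation_eq X R (map (\<lambda>(x, b). (x, \<not> b)) (rev u) @ u) []"
proof (induction u)
  case Nil
  then show ?case by (auto intro: presentation_eq.refl)
next
  case (Cons l u)
  obtain x b where l: "l = (x, b)" by (cases l)
  let ?v = "map (\<lambda>(x, b). (x, \<not> b)) (rev u)"
  have "u \<in> words X" "x \<in> X" "?v \<in> words X"
    using Cons.prems by (auto simp: l words_def)
  then have "presentation_eq X R (?v @ [(x, \<not> b), (x, \<not> \<not> b)] @ u) (?v @ u)"
    by (intro presentation_eq.cancel)
  from presentation_eq.trans[OF this Cons.IH[OF \<open>u \<in> words X\<close>]] show ?case
    by (simp add: l)
qed

lemma group_presented_group:
  assumes R: "R \<subseteq> words X"
  shows "group (presented_group X R)"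
proof (rule groupI)
  let ?P = "presented_group X R" and ?c = "\<lambda>u. presentation_rel X R `` {u}"
  have car: "carrier ?P = ?c ` words X"
    by (auto simp: presented_group_def quotient_def)
  have one: "\<one>\<^bsub>?P\<^esub> = ?c []" by (simp add: presented_group_def)
  have Nil: "[] \<in> words X" by (simp add: words_def)
  have app: "u @ v \<in> words X" if "u \<in> words X" "v \<in> words X" for u v
    using that by (simp add: words_def)
  note m = presented_group_mult_class[OF R]
  show "\<one>\<^bsub>?P\<^esub> \<in> carrier ?P" using Nil by (simp add: car one)
  show "x \<otimes>\<^bsub>?P\<^esub> y \<in> carrier ?P" if "x \<in> carrier ?P" "y \<in> carrier ?P" for x y
    using that by (auto simp: car m app)
  show "x \<otimes>\<^bsub>?P\<^esub> y \<otimes>\<^bsub>?P\<^esub> z = x \<otimes>\<^bsub>?P\<^esub> (y \<otimes>\<^bsub>?P\<^esub> z)"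
    if "x \<in> carrier ?P" "y \<in> carrier ?P" "z \<in> carrier ?P" for x y z
    using that by (auto simp: car m app)
  show "\<one>\<^bsub>?P\<^esub> \<otimes>\<^bsub>?P\<^esub> x = x" if "x \<in> carrier ?P" for x
    using that Nil by (auto simp: car m one)
  show "\<exists>y\<in>carrier ?P. y \<otimes>\<^bsub>?P\<^esub> x = \<one>\<^bsub>?P\<^esub>" if x: "x \<in> carrier ?P" for x
  proof -
    obtain u where u: "u \<in> words X" "x = ?c u" using x unfolding car by blast
    let ?v = "map (\<lambda>(x, b). (x, \<not> b)) (rev u)"
    have v: "?v \<in> words X" using u by (auto simp: words_def)
    have "?c (?v @ u) = ?c []"
      using presentation_eq_inverse[OF u(1), of R]
      by (intro equiv_class_eq[OF equiv_presentation_rel[OF R]]) (simp add: presentation_rel_def)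
    then show ?thesis
      using u v by (intro bexI[of _ "?c ?v"]) (auto simp: car m one)
  qed
qed

lemma group_raag:
  assumes "pair_graph G"
  shows "group (raag G)"
proof -
  interpret pair_graph G by fact
  show ?thesis
    unfolding raag_def
    by (intro group_presented_group) (auto simp: words_def dest: in_arcsD1 in_arcsD2)
qed

end

theory Submission
  imports Defs
begin

text \<open>
  The heart of the matter is a pair \<open>S = {a, b}\<close> of non-adjacent vertices. Call the new vertex \<open>a\<close>
  again, so that the co-contraction has the vertices of \<open>G\<close> other than \<open>b\<close>, and \<open>a\<close> is now joined
  only to the common neighbours of \<open>a\<close> and \<open>b\<close>. The embedding sends \<open>a\<close> to \<open>b\<^sup>-\<^sup>1 a b\<close> and fixes
  the other generators. It is well defined because a common neighbour of \<open>a\<close> and \<open>b\<close> commutes with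
  \<open>b\<^sup>-\<^sup>1 a b\<close>.

  For injectivity, let \<open>D\<close> be the double of \<open>G - b\<close> along the link of \<open>b\<close>: two copies, or sheets, of
  \<open>G - b\<close> glued along the neighbours of \<open>b\<close>. Sending \<open>b\<close> to the involution that exchanges the sheets,
  and every other vertex to its copy in the first sheet, gives a homomorphism from \<open>A(G)\<close> to
  \<open>A(D) \<rtimes> Z/2\<close>, under which \<open>b\<^sup>-\<^sup>1 a b\<close> becomes the copy of \<open>a\<close> in the second sheet. This
  second copy of \<open>a\<close> is joined exactly to those neighbours of \<open>a\<close> that lie in the link of \<open>b\<close>;
  together with the vertices other than \<open>a\<close> in the first sheet it spans a copy of the co-contraction
  as an induced subgraph of \<open>D\<close>. Deleting all other vertices is a retraction of \<open>A(D)\<close> onto the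
  group of this subgraph, so the composite recovers each word. The function \<open>reading\<close> is this
  composite on words: it remembers the current sheet, switches sheets at each \<open>b\<close>, and prints the
  letters that survive the retraction; \<open>reading_eq\<close> says that it respects the relations of \<open>A(G)\<close>.

  A general \<open>S\<close> is absorbed one vertex at a time. Anti-connectedness provides, for each proper
  nonempty part \<open>T\<close> of \<open>S\<close>, a vertex of \<open>S - T\<close> that misses a vertex of \<open>T\<close>, hence is not adjacent
  to the vertex that replaces \<open>T\<close>, and the case of a pair applies
  (\<open>anti_connected_nonadjacent_pair\<close>, \<open>mon_co_collapse\<close>).
\<close>

section \<open>Homomorphisms between presented groups\<close>

declare presentation_eq.trans [trans]

lemma append_in_words [simp]: "u @ v \<in> words X \<longleftrightarrow> u \<in> words X \<and> v \<in> words X"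
  by (auto simp: words_def)

lemma Cons_in_words [simp]: "l # u \<in> words X \<longleftrightarrow> fst l \<in> X \<and> u \<in> words X"
  by (cases l) (auto simp: words_def)

lemma Nil_in_words [simp]: "[] \<in> words X"
  by (simp add: words_def)

lemma concat_map_in_words:
  assumes "\<And>x b. x \<in> X \<Longrightarrow> g (x, b) \<in> words Y" and "u \<in> words X"
  shows "concat (map g u) \<in> words Y"
  using assms(2) by (induction u) (use assms(1) in \<open>auto simp: prod.collapse\<close>)

lemma presentation_eq_context:
  assumes "presentation_eq X R p q" and "u \<in> words X" and "v \<in> words X"
  shows "presentation_eq X R (u @ p @ v) (u @ q @ v)"
  using assms by (intro presentation_eq_append_left presentation_eq_append_right)

lemma presentation_eq_concat_map:
  assumes "presentation_eq X R u v"
    and g: "\<And>x b. x \<in> X \<Longrightarrow> g (x, b) \<in> words Y"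
    and inv: "\<And>x b. x \<in> X \<Longrightarrow> presentation_eq Y Q (g (x, b) @ g (x, \<not> b)) []"
    and rel: "\<And>r. r \<in> R \<Longrightarrow> presentation_eq Y Q (concat (map g r)) []"
  shows "presentation_eq Y Q (concat (map g u)) (concat (map g v))"
  using assms(1)
proof induction
  case (refl u)
  then show ?case by (intro presentation_eq.refl concat_map_in_words) (auto simp: g)
next
  case (sym u v)
  then show ?case by (blast intro: presentation_eq.sym)
next
  case (trans u v w)
  then show ?case by (blast intro: presentation_eq.trans)
next
  case (cancel u v x b)
  then show ?case
    using presentation_eq_context[OF inv[of x b], of "concat (map g u)" "concat (map g v)"]
    by (simp add: concat_map_in_words[where g = g, OF g])
next
  case (relator u v r)
  then show ?case
    using presentation_eq_context[OF rel[of r], of "concat (map g u)" "concat (map g v)"]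
    by (simp add: concat_map_in_words[where g = g, OF g])
qed

text \<open>
  Injectivity is certified by a left inverse on words that respects the relations. Only \<open>\<phi>\<close> is
  compatible with concatenation; \<open>\<psi>\<close> may be a machine with memory, such as \<open>reading\<close> below.
\<close>
lemma mon_presented_groupI:
  assumes R: "R \<subseteq> words X" and Q: "Q \<subseteq> words Y"
    and words: "\<And>u. u \<in> words X \<Longrightarrow> \<phi> u \<in> words Y"
    and app: "\<And>u v. \<phi> (u @ v) = \<phi> u @ \<phi> v"
    and eq: "\<And>u v. presentation_eq X R u v \<Longrightarrow> presentation_eq Y Q (\<phi> u) (\<phi> v)"
    and eq': "\<And>p q. presentation_eq Y Q p q \<Longrightarrow> presentation_eq X R (\<psi> p) (\<psi> q)"
    and inv: "\<And>u. u \<in> words X \<Longrightarrow> \<psi> (\<phi> u) = u"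
  shows "\<exists>f. f \<in> mon (presented_group X R) (presented_group Y Q)"
proof -
  let ?P = "presented_group X R" and ?c = "\<lambda>u. presentation_rel X R `` {u}"
  let ?P' = "presented_group Y Q" and ?c' = "\<lambda>u. presentation_rel Y Q `` {u}"
  note equiv = equiv_presentation_rel[OF R] and equiv' = equiv_presentation_rel[OF Q]
  define f where "f A = (\<Union>u\<in>A. ?c' (\<phi> u))" for A
  have car: "carrier ?P = ?c ` words X" and car': "carrier ?P' = ?c' ` words Y"
    by (auto simp: presented_group_def quotient_def)
  have f: "f (?c u) = ?c' (\<phi> u)" if u: "u \<in> words X" for u
  proof -
    have "?c' (\<phi> v) = ?c' (\<phi> u)" if "v \<in> ?c u" for v
      using equiv_class_eq[OF equiv'] eq[OF presentation_eq.sym, of u v] that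
      by (simp add: presentation_rel_def)
    then have "f (?c u) = (\<Union>v\<in>?c u. ?c' (\<phi> u))" unfolding f_def by (rule SUP_cong[OF HOL.refl])
    moreover have "u \<in> ?c u" using equiv_class_self[OF equiv u] .
    ultimately show ?thesis by (simp only: UN_constant) auto
  qed
  have "f \<in> hom ?P ?P'"
    by (rule homI) (auto simp: car car' f words app presented_group_mult_class[OF R]
        presented_group_mult_class[OF Q])
  moreover have "inj_on f (carrier ?P)"
  proof (rule inj_onI)
    fix A B assume "A \<in> carrier ?P" "B \<in> carrier ?P" and AB: "f A = f B"
    then obtain u v where u: "u \<in> words X" "A = ?c u" and v: "v \<in> words X" "B = ?c v"
      unfolding car by blast
    have "?c' (\<phi> u) = ?c' (\<phi> v)" using AB u v f by metis
    then have "presentation_eq Y Q (\<phi> u) (\<phi> v)"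
      using eq_equiv_class[OF _ equiv' words[OF v(1)]] by (simp add: presentation_rel_def)
    then have "presentation_eq X R u v" using eq'[of "\<phi> u" "\<phi> v"] u v by (simp add: inv)
    then show "A = B" using equiv_class_eq[OF equiv] u v by (simp add: presentation_rel_def)
  qed
  ultimately show ?thesis by (auto simp: mon_def)
qed

section \<open>Commutation in right-angled Artin groups\<close>

definition raag_relators :: "'a pair_pre_digraph \<Rightarrow> 'a word set" where
  "raag_relators G =
    {[(v, True), (w, True), (v, False), (w, False)] | v w. (v, w) \<in> parcs G}"

abbreviation raag_eq :: "'a pair_pre_digraph \<Rightarrow> 'a word \<Rightarrow> 'a word \<Rightarrow> bool" where
  "raag_eq G \<equiv> presentation_eq (pverts G) (raag_relators G)"

lemma raag_alt: "raag G = presented_group (pverts G) (raag_relators G)"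
  by (simp add: raag_def raag_relators_def)

context pair_graph
begin

lemma raag_relators_words: "raag_relators G \<subseteq> words (pverts G)"
  by (auto simp: raag_relators_def dest: in_arcsD1 in_arcsD2)

lemma parcs_sym: "(u, v) \<in> parcs G \<Longrightarrow> (v, u) \<in> parcs G"
  using pair_sym_arcs by (auto simp: symmetric_def sym_def)

text \<open>
  A homomorphism is determined by the images of the generators, and the image of a relator has the
  shape \<open>u v u' v'\<close> where \<open>u'\<close> and \<open>v'\<close> are the images of the inverse letters. Keeping them as
  separate words avoids computing inverses of words.
\<close>
lemma raag_eq_commutator:
  assumes "raag_eq G (u @ v) (v @ u)"
    and "raag_eq G (u @ u') []" and "raag_eq G (v @ v') []"
    and "u \<in> words (pverts G)" "v \<in> words (pverts G)" "u' \<in> words (pverts G)" "v' \<in> words (pverts G)"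
  shows "raag_eq G (u @ v @ u' @ v') []"
proof -
  have "raag_eq G ((u @ v) @ u' @ v') ((v @ u) @ u' @ v')"
    using assms by (intro presentation_eq_append_right) auto
  also have "raag_eq G ((v @ u) @ u' @ v') (v @ v')"
    using presentation_eq_context[OF assms(2), of v v'] assms by simp
  also note assms(3)
  finally show ?thesis by simp
qed

text \<open>
  What commutes with \<open>x\<close> commutes with \<open>x\<^sup>-\<^sup>1\<close>: insert \<open>x x\<^sup>-\<^sup>1\<close> at the end, move \<open>x\<close> to the front
  across \<open>v\<close>, and cancel there.
\<close>
lemma raag_eq_swap_inverse:
  assumes "raag_eq G ([(x, d)] @ v) (v @ [(x, d)])"
    and "x \<in> pverts G" and "v \<in> words (pverts G)"
  shows "raag_eq G ([(x, \<not> d)] @ v) (v @ [(x, \<not> d)])"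
proof -
  have "raag_eq G (([(x, \<not> d)] @ v) @ [(x, d), (x, \<not> d)] @ []) (([(x, \<not> d)] @ v) @ [])"
    using assms by (intro presentation_eq.cancel) auto
  then have "raag_eq G ([(x, \<not> d)] @ v) ([(x, \<not> d)] @ (v @ [(x, d)]) @ [(x, \<not> d)])"
    by (simp add: presentation_eq.sym)
  also
  have "raag_eq G \<dots> ([(x, \<not> d)] @ ([(x, d)] @ v) @ [(x, \<not> d)])"
    using assms by (intro presentation_eq_context) (auto intro: presentation_eq.sym)
  also
  have "raag_eq G \<dots> (v @ [(x, \<not> d)])"
    using presentation_eq.cancel[of "[]" "pverts G" "v @ [(x, \<not> d)]" x "raag_relators G" "\<not> d"] assms
    by simp
  finally show ?thesis .
qed

text \<open>
  The relators speak of positive letters; the other three sign patterns follow by inverting one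
  letter at a time.
\<close>
lemma raag_eq_swap_letters:
  assumes arc: "(x, y) \<in> parcs G"
  shows "raag_eq G ([(x, d)] @ [(y, e)]) ([(y, e)] @ [(x, d)])"
proof -
  have x: "x \<in> pverts G" and y: "y \<in> pverts G" using arc by (auto dest: in_arcsD1 in_arcsD2)
  let ?r = "[(x, True), (y, True), (x, False), (y, False)]"
  have "raag_eq G ([] @ ?r @ [(y, True), (x, True)]) ([] @ [(y, True), (x, True)])"
    using arc x y by (intro presentation_eq.relator) (auto simp: raag_relators_def)
  moreover have "raag_eq G ([(x, True), (y, True), (x, False)] @ [(y, False), (y, \<not> False)] @ [(x, True)])
    ([(x, True), (y, True), (x, False)] @ [(x, True)])"
    using x y by (intro presentation_eq.cancel) auto
  moreover have "raag_eq G ([(x, True), (y, True)] @ [(x, False), (x, \<not> False)] @ [])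
    ([(x, True), (y, True)] @ [])"
    using x y by (intro presentation_eq.cancel) auto
  ultimately have TT: "raag_eq G ([(x, True)] @ [(y, True)]) ([(y, True)] @ [(x, True)])"
    by simp (blast intro: presentation_eq.sym presentation_eq.trans)
  have T: "raag_eq G ([(x, d)] @ [(y, True)]) ([(y, True)] @ [(x, d)])"
    using TT raag_eq_swap_inverse[OF TT] x y by (cases d) auto
  from raag_eq_swap_inverse[OF presentation_eq.sym[OF T]] T show ?thesis
    using x y by (cases e) (auto intro: presentation_eq.sym)
qed

lemma raag_eq_swap_words:
  assumes "\<And>x d y e. (x, d) \<in> set u \<Longrightarrow> (y, e) \<in> set v \<Longrightarrow> (x, y) \<in> parcs G"
    and "u \<in> words (pverts G)" and "v \<in> words (pverts G)"
  shows "raag_eq G (u @ v) (v @ u)"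
proof -
  have letter: "raag_eq G ([(x, d)] @ v) (v @ [(x, d)])"
    if "x \<in> pverts G" "\<And>y e. (y, e) \<in> set v \<Longrightarrow> (x, y) \<in> parcs G" for x d
    using that assms(3)
  proof (induction v)
    case Nil
    then show ?case by (auto intro: presentation_eq.refl)
  next
    case (Cons l v)
    obtain y e where l: "l = (y, e)" by (cases l)
    have "raag_eq G (([(x, d)] @ [l]) @ v) (([l] @ [(x, d)]) @ v)"
      unfolding l using Cons.prems(2)[of y e] Cons.prems l
      by (intro presentation_eq_append_right raag_eq_swap_letters) auto
    moreover have "raag_eq G ([l] @ [(x, d)] @ v) ([l] @ v @ [(x, d)])"
      using Cons by (intro presentation_eq_append_left) auto
    ultimately show ?case by simp (rule presentation_eq.trans)
  qed
  show ?thesis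
    using assms(1,2)
  proof (induction u)
    case Nil
    then show ?case using assms by (auto intro: presentation_eq.refl)
  next
    case (Cons l u)
    obtain x d where l: "l = (x, d)" by (cases l)
    have swap: "raag_eq G ([l] @ u @ v) ([l] @ v @ u)"
      using Cons by (intro presentation_eq_append_left) auto
    have "x \<in> pverts G" using Cons.prems(2) l by simp
    moreover have "(x, y) \<in> parcs G" if "(y, e) \<in> set v" for y e
      using Cons.prems(1)[of x d y e] that l by simp
    ultimately have "raag_eq G ([l] @ v) (v @ [l])" unfolding l by (intro letter)
    then have "raag_eq G (([l] @ v) @ u) ((v @ [l]) @ u)"
      using Cons.prems(2) by (intro presentation_eq_append_right) auto
    with swap show ?case by simp (rule presentation_eq.trans)
  qed
qed

end

lemma raag_eq_rename:
  assumes "raag_eq G u v"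
    and verts: "\<And>u. u \<in> pverts G \<Longrightarrow> m u \<in> pverts H"
    and arcs: "\<And>u v. (u, v) \<in> parcs G \<Longrightarrow> (m u, m v) \<in> parcs H"
  shows "raag_eq H (concat (map (\<lambda>(x, e). [(m x, e)]) u)) (concat (map (\<lambda>(x, e). [(m x, e)]) v))"
  using assms(1)
proof (rule presentation_eq_concat_map)
  show "raag_eq H ((\<lambda>(x, e). [(m x, e)]) (x, b) @ (\<lambda>(x, e). [(m x, e)]) (x, \<not> b)) []"
    if "x \<in> pverts G" for x b
    using presentation_eq.cancel[of "[]" "pverts H" "[]" "m x" "raag_relators H" b] that verts
    by simp
  show "raag_eq H (concat (map (\<lambda>(x, e). [(m x, e)]) r)) []" if "r \<in> raag_relators G" for r
    using presentation_eq.relator[of "[]" "pverts H" "[]" "concat (map (\<lambda>(x, e). [(m x, e)]) r)"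
        "raag_relators H"] that arcs
    by (auto simp: raag_relators_def)
qed (use verts in auto)

lemma raag_iso_mon:
  assumes "pair_graph G" and "pair_graph H"
    and h: "\<And>u. u \<in> pverts G \<Longrightarrow> h u \<in> pverts H" "\<And>u v. (u, v) \<in> parcs G \<Longrightarrow> (h u, h v) \<in> parcs H"
    and k: "\<And>u. u \<in> pverts H \<Longrightarrow> k u \<in> pverts G" "\<And>u v. (u, v) \<in> parcs H \<Longrightarrow> (k u, k v) \<in> parcs G"
    and kh: "\<And>u. u \<in> pverts G \<Longrightarrow> k (h u) = u"
  shows "\<exists>f. f \<in> mon (raag G) (raag H)"
proof -
  interpret G: pair_graph G by fact
  interpret H: pair_graph H by fact
  show ?thesis
    unfolding raag_alt
  proof (rule mon_presented_groupI[OF G.raag_relators_words H.raag_relators_words])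
    show "concat (map (\<lambda>(x, e). [(h x, e)]) u) \<in> words (pverts H)" if "u \<in> words (pverts G)" for u
      using that h by (intro concat_map_in_words) auto
    show "concat (map (\<lambda>(x, e). [(k x, e)]) (concat (map (\<lambda>(x, e). [(h x, e)]) u))) = u"
      if "u \<in> words (pverts G)" for u
      using that by (induction u) (auto simp: kh)
    show "raag_eq H (concat (map (\<lambda>(x, e). [(h x, e)]) u)) (concat (map (\<lambda>(x, e). [(h x, e)]) v))"
      if "raag_eq G u v" for u v
      using that h by (rule raag_eq_rename)
    show "raag_eq G (concat (map (\<lambda>(x, e). [(k x, e)]) u)) (concat (map (\<lambda>(x, e). [(k x, e)]) v))"
      if "raag_eq H u v" for u v
      using that k by (rule raag_eq_rename)
  qed simp
qed

section \<open>Collapsing onto a vertex\<close>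

text \<open>
  The vertices of the original graph that a vertex of the collapsed graph stands for.
\<close>
definition fibre :: "'a \<Rightarrow> 'a set \<Rightarrow> 'a \<Rightarrow> 'a set" where
  "fibre a S u = (if u = a then S else {u})"

text \<open>
  The co-contraction relative to \<open>S\<close>, with the new vertex called \<open>a\<close>, where \<open>a\<close> is meant to be a
  member of \<open>S\<close>. The vertex type does not change, so collapses can be iterated. Two vertices are
  joined when all vertices they stand for are joined; since a set that contains a vertex is not
  joined to itself, this excludes a loop at \<open>a\<close>.
\<close>
definition co_collapse :: "'a pair_pre_digraph \<Rightarrow> 'a \<Rightarrow> 'a set \<Rightarrow> 'a pair_pre_digraph" where
  "co_collapse G a S =
    \<lparr>pverts = insert a (pverts G - S),
     parcs = {(u, v). u \<in> insert a (pverts G - S) \<and> v \<in> insert a (pverts G - S) \<and>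
       fibre a S u \<times> fibre a S v \<subseteq> parcs G}\<rparr>"

lemma pair_graph_co_collapse:
  assumes "pair_graph G" and "a \<in> S"
  shows "pair_graph (co_collapse G a S)"
proof -
  interpret pair_graph G by fact
  have *: "parcs (co_collapse G a S) \<subseteq> pverts (co_collapse G a S) \<times> pverts (co_collapse G a S)"
    by (auto simp: co_collapse_def)
  have fin: "finite (pverts (co_collapse G a S))"
    by (simp add: co_collapse_def pair_finite_verts)
  have "finite (parcs (co_collapse G a S))"
    using * fin by (meson finite_SigmaI finite_subset)
  moreover have "sym (parcs (co_collapse G a S))"
    by (intro symI) (auto simp: co_collapse_def intro: parcs_sym)
  moreover have "fst e \<noteq> snd e" if "e \<in> parcs (co_collapse G a S)" for e
    using that pair_no_loops[of "(a, a)"] pair_no_loops[of e] \<open>a \<in> S\<close>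
    by (auto simp: co_collapse_def fibre_def split: if_splits)
  ultimately show ?thesis
    using fin * by unfold_locales (auto simp: symmetric_def)
qed

lemma co_collapse_singleton:
  assumes "pair_graph G" and "a \<in> pverts G"
  shows "co_collapse G a {a} = G"
proof -
  interpret pair_graph G by fact
  have "parcs G \<subseteq> pverts G \<times> pverts G" by (auto dest: in_arcsD1 in_arcsD2)
  then show ?thesis using assms(2)
    by (intro pair_pre_digraph.equality) (auto simp: co_collapse_def fibre_def)
qed

text \<open>
  Collapses compose because fibres do: the fibre of \<open>a\<close> under the second collapse is \<open>{a, b}\<close>, and
  these two stand for \<open>S\<close> and \<open>b\<close>.
\<close>
lemma co_collapse_insert:
  assumes "a \<in> S" and "b \<in> pverts G - S"
  shows "co_collapse (co_collapse G a S) a {a, b} = co_collapse G a (insert b S)"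
  using assms
  by (intro pair_pre_digraph.equality) (auto simp: co_collapse_def fibre_def split: if_splits)

section \<open>Collapsing a pair of non-adjacent vertices\<close>

text \<open>
  Whether the copy of \<open>x\<close> in sheet \<open>s\<close> of the double survives the retraction. The first sheet is
  \<open>False\<close>. A neighbour \<open>x\<close> of \<open>b\<close> has a single copy, lying in both sheets, so it is visible from
  either one.
\<close>
definition visible :: "'a pair_pre_digraph \<Rightarrow> 'a \<Rightarrow> 'a \<Rightarrow> bool \<Rightarrow> 'a \<Rightarrow> bool" where
  "visible G a b s x \<longleftrightarrow> (if s then x = a \<or> (b, x) \<in> parcs G else x \<noteq> a)"

text \<open>
  The sheet in which a word ends when read from sheet \<open>s\<close>. Exchanging the sheets is an involution,
  so the letters \<open>b\<close> and \<open>b\<^sup>-\<^sup>1\<close> act alike and their signs are ignored.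
\<close>
fun sheet :: "'a \<Rightarrow> bool \<Rightarrow> 'a word \<Rightarrow> bool" where
  "sheet b s [] = s"
| "sheet b s ((x, e) # u) = sheet b (if x = b then \<not> s else s) u"

fun reading :: "'a pair_pre_digraph \<Rightarrow> 'a \<Rightarrow> 'a \<Rightarrow> bool \<Rightarrow> 'a word \<Rightarrow> 'a word" where
  "reading G a b s [] = []"
| "reading G a b s ((x, e) # u) =
    (if x = b then reading G a b (\<not> s) u
     else if visible G a b s x then (x, e) # reading G a b s u
     else reading G a b s u)"

lemma sheet_append: "sheet b s (u @ v) = sheet b (sheet b s u) v"
  by (induction b s u rule: sheet.induct) auto

lemma reading_append: "reading G a b s (u @ v) = reading G a b s u @ reading G a b (sheet b s u) v"
  by (induction G a b s u rule: reading.induct) auto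

context pair_graph
begin

context
  fixes a b
  assumes a: "a \<in> pverts G" and b: "b \<in> pverts G" and "a \<noteq> b" and nonadj: "(a, b) \<notin> parcs G"
begin

lemma pverts_pair: "pverts (co_collapse G a {a, b}) = pverts G - {b}"
  using a \<open>a \<noteq> b\<close> by (auto simp: co_collapse_def)

lemma reading_words:
  "u \<in> words (pverts G) \<Longrightarrow> reading G a b s u \<in> words (pverts (co_collapse G a {a, b}))"
  unfolding pverts_pair by (induction G a b s u rule: reading.induct) auto

lemma parcs_pair:
  "(u, v) \<in> parcs (co_collapse G a {a, b}) \<longleftrightarrow> u \<noteq> b \<and> v \<noteq> b \<and> (u, v) \<in> parcs G \<and>
    (u = a \<longrightarrow> (b, v) \<in> parcs G) \<and> (v = a \<longrightarrow> (u, b) \<in> parcs G)"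
  using \<open>a \<noteq> b\<close> a pair_no_loops[of "(a, a)"] nonadj
  by (auto simp: co_collapse_def fibre_def dest: in_arcsD1 in_arcsD2 split: if_splits)

text \<open>
  If \<open>b\<close> is one of the two letters, the other is a neighbour of \<open>b\<close>, hence visible from both sheets,
  and its two occurrences cancel. Otherwise the whole relator is read in one sheet. If an invisible
  letter is dropped the rest cancels; if both are visible they are still adjacent after the collapse,
  which has to be checked only when one of them is \<open>a\<close>: this is visible only in the second sheet,
  and everything else visible there is adjacent to \<open>b\<close>.
\<close>
lemma reading_relator:
  assumes "(v, w) \<in> parcs G"
  shows "raag_eq (co_collapse G a {a, b})
    (reading G a b s [(v, True), (w, True), (v, False), (w, False)]) []"
proof -
  let ?H = "co_collapse G a {a, b}"
  interpret H: pair_graph ?H by (rule pair_graph_co_collapse) (simp_all add: pair_graph_axioms)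
  have vw: "v \<in> pverts G" "w \<in> pverts G" "v \<noteq> w"
    using assms pair_no_loops[of "(v, w)"] by (auto dest: in_arcsD1 in_arcsD2)
  have canc: "raag_eq ?H [(x, d), (x, \<not> d)] []" if "x \<in> pverts G" "x \<noteq> b" for x d
    using presentation_eq.cancel[of "[]" "pverts ?H" "[]" x "raag_relators ?H" d] that
    by (simp add: pverts_pair)
  note canc' = canc[of _ True, simplified]
  have "(b, a) \<notin> parcs G" using nonadj parcs_sym by blast
  moreover have "(v, b) \<in> parcs G \<longleftrightarrow> (b, v) \<in> parcs G" "(w, b) \<in> parcs G \<longleftrightarrow> (b, w) \<in> parcs G"
    using parcs_sym by blast+
  moreover have rel: "raag_eq ?H [(v, True), (w, True), (v, False), (w, False)] []"
    if "(v, w) \<in> parcs ?H"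
    using presentation_eq.relator[of "[]" "pverts ?H" "[]" _ "raag_relators ?H"] that
    by (force simp: raag_relators_def)
  ultimately show ?thesis
    using assms vw canc' nonadj \<open>a \<noteq> b\<close>
    by (auto simp: visible_def parcs_pair intro: presentation_eq.refl)
qed

text \<open>
  The rest of the word is unaffected by an inserted piece that returns to its own sheet. The
  hypotheses range over both sheets because the prefix \<open>u\<close> decides where the piece is read.
\<close>
lemma reading_eq_insert:
  assumes "\<And>t. sheet b t r = t"
    and "\<And>t. raag_eq (co_collapse G a {a, b}) (reading G a b t r) []"
    and "u \<in> words (pverts G)" and "v \<in> words (pverts G)"
  shows "sheet b s (u @ r @ v) = sheet b s (u @ v) \<and>
    raag_eq (co_collapse G a {a, b}) (reading G a b s (u @ r @ v)) (reading G a b s (u @ v))"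
  using presentation_eq_context[OF assms(2)[of "sheet b s u"] reading_words[OF assms(3), of s]
      reading_words[OF assms(4), of "sheet b s u"]] assms(1)
  by (simp add: sheet_append reading_append)

lemma reading_eq:
  assumes "raag_eq G u v"
  shows "sheet b s u = sheet b s v \<and>
    raag_eq (co_collapse G a {a, b}) (reading G a b s u) (reading G a b s v)"
  using assms
proof (induction arbitrary: s)
  case (refl u)
  then show ?case by (auto intro: presentation_eq.refl reading_words)
next
  case (sym u v)
  then show ?case by (auto intro: presentation_eq.sym)
next
  case (trans u v w)
  then show ?case by (metis presentation_eq.trans)
next
  case (cancel u v x e)
  let ?H = "co_collapse G a {a, b}"
  have "raag_eq ?H (reading G a b t [(x, e), (x, \<not> e)]) []" for t
    using presentation_eq.cancel[of "[]" "pverts ?H" "[]" x "raag_relators ?H" e] cancel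
    by (auto simp: pverts_pair intro: presentation_eq.refl)
  then show ?case using cancel by (intro reading_eq_insert) auto
next
  case (relator u v r)
  then obtain x y where "(x, y) \<in> parcs G"
    and r: "r = [(x, True), (y, True), (x, False), (y, False)]"
    by (auto simp: raag_relators_def)
  then have "raag_eq (co_collapse G a {a, b}) (reading G a b t r) []" for t
    unfolding r by (intro reading_relator)
  moreover have "sheet b t r = t" for t by (simp add: r)
  ultimately show ?case using relator by (intro reading_eq_insert) auto
qed

definition conjugate_letter :: "'a \<times> bool \<Rightarrow> 'a word" where
  "conjugate_letter l = (if fst l = a then [(b, False), l, (b, True)] else [l])"

text \<open>
  The left inverse reads from the sheet \<open>False\<close>: in \<open>b\<^sup>-\<^sup>1 a b\<close> the first letter leads to the sheet
  where \<open>a\<close> is visible and the last one leads back, while a vertex other than \<open>a\<close> and \<open>b\<close> is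
  visible at once.
\<close>
lemma mon_co_collapse_pair:
  "\<exists>f. f \<in> mon (raag (co_collapse G a {a, b})) (raag G)"
proof -
  let ?H = "co_collapse G a {a, b}"
  let ?\<phi> = "\<lambda>u. concat (map conjugate_letter u)"
  interpret H: pair_graph ?H by (rule pair_graph_co_collapse) (simp_all add: pair_graph_axioms)
  have letter: "conjugate_letter (x, d) \<in> words (pverts G)" if "x \<in> pverts ?H" for x d
    using that b by (auto simp: conjugate_letter_def pverts_pair)
  have inv: "raag_eq G (conjugate_letter (x, d) @ conjugate_letter (x, \<not> d)) []" if "x \<in> pverts ?H" for x d
  proof -
    have x: "x \<in> pverts G" using that by (simp add: pverts_pair)
    have 1: "raag_eq G [(y, e), (y, \<not> e)] []" if "y \<in> pverts G" for y e
      using presentation_eq.cancel[of "[]" "pverts G" "[]" y "raag_relators G" e] that by simp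
    have "raag_eq G ([(b, False), (x, d)] @ [(b, True), (b, \<not> True)] @ [(x, \<not> d), (b, True)])
      ([(b, False), (x, d)] @ [(x, \<not> d), (b, True)])"
      using x b by (intro presentation_eq.cancel) auto
    moreover have "raag_eq G ([(b, False)] @ [(x, d), (x, \<not> d)] @ [(b, True)])
      ([(b, False)] @ [(b, True)])"
      using x b by (intro presentation_eq.cancel) auto
    ultimately have "raag_eq G [(b, False), (x, d), (b, True), (b, False), (x, \<not> d), (b, True)] []"
      using 1[OF b, of False] by simp (blast intro: presentation_eq.trans)
    then show ?thesis using 1[OF x] by (cases "x = a") (simp_all add: conjugate_letter_def)
  qed
  have rel: "raag_eq G (?\<phi> r) []" if r: "r \<in> raag_relators ?H" for r
  proof -
    obtain v w where vw: "(v, w) \<in> parcs ?H" and r: "r = [(v, True), (w, True), (v, False), (w, False)]"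
      using r by (auto simp: raag_relators_def)
    have vw': "v \<in> pverts ?H" "w \<in> pverts ?H" "v \<noteq> w"
      using vw H.pair_no_loops[of "(v, w)"] by (auto dest: H.in_arcsD1 H.in_arcsD2)
    have "raag_eq G (conjugate_letter (v, True) @ conjugate_letter (w, True))
      (conjugate_letter (w, True) @ conjugate_letter (v, True))"
      using vw vw' letter
      by (intro raag_eq_swap_words)
        (auto simp: conjugate_letter_def parcs_pair intro: parcs_sym split: if_splits)
    then show ?thesis
      using raag_eq_commutator[of "conjugate_letter (v, True)" "conjugate_letter (w, True)"
        "conjugate_letter (v, False)" "conjugate_letter (w, False)"] letter vw' inv[of _ True]
      by (simp add: r)
  qed
  show ?thesis
    unfolding raag_alt
  proof (rule mon_presented_groupI[OF H.raag_relators_words raag_relators_words])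
    show "?\<phi> u \<in> words (pverts G)" if "u \<in> words (pverts ?H)" for u
      using letter that by (rule concat_map_in_words)
    show "raag_eq G (?\<phi> u) (?\<phi> v)" if "raag_eq ?H u v" for u v
      using that letter inv rel by (rule presentation_eq_concat_map)
    show "raag_eq ?H (reading G a b False p) (reading G a b False q)" if "raag_eq G p q" for p q
      using reading_eq[OF that] by simp
    show "reading G a b False (?\<phi> u) = u" if "u \<in> words (pverts ?H)" for u
      using that \<open>a \<noteq> b\<close> by (induction u) (auto simp: conjugate_letter_def visible_def pverts_pair)
  qed simp
qed

end

end

section \<open>Collapsing an anti-connected set\<close>

lemma mon_compose:
  assumes "f \<in> mon G H" and "g \<in> mon H K"
  shows "g \<circ> f \<in> mon G K"
proof -
  have "f ` carrier G \<subseteq> carrier H" using assms(1) by (auto simp: mon_def hom_def)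
  then have "inj_on (g \<circ> f) (carrier G)"
    using assms by (auto simp: mon_def intro: comp_inj_on inj_on_subset)
  moreover have "g \<circ> f \<in> hom G K"
    using assms by (auto simp: mon_def hom_def Pi_iff)
  ultimately show ?thesis by (simp add: mon_def)
qed

text \<open>
  A path in the complement from inside \<open>T\<close> to outside \<open>T\<close> has a first edge that leaves \<open>T\<close>.
\<close>
lemma anti_connected_nonadjacent_pair:
  assumes "pair_graph G" and "anti_connected G S" and "T \<subset> S" and "T \<noteq> {}"
  obtains s b where "s \<in> T" "b \<in> S - T" "(s, b) \<notin> parcs G"
proof -
  interpret pair_graph G by fact
  define K where "K = mk_symmetric (with_proj (complement_graph G) \<restriction> S)"
  obtain s t where s: "s \<in> T" and t: "t \<in> S - T" using assms by blast
  have verts: "pverts K = S" by (simp add: K_def mk_symmetric_def induce_subgraph_def)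
  have "s \<rightarrow>\<^sup>*\<^bsub>with_proj K\<^esub> t"
    using assms(2,3) s t
    unfolding anti_connected_def connected_def strongly_connected_def K_def[symmetric]
    by (auto simp: verts)
  then have "(s, t) \<in> (parcs K)\<^sup>*"
    by (auto dest: reachable_rtranclI simp: arcs_ends_def arc_to_ends_def)
  moreover have "\<exists>x y. x \<in> T \<and> y \<in> S - T \<and> (x, y) \<in> parcs K"
    if "(s, t) \<in> (parcs K)\<^sup>*" "t \<notin> T" for t
    using that
  proof (induction rule: rtrancl_induct)
    case base
    then show ?case using s by simp
  next
    case (step x y)
    have "y \<in> S" using step.hyps by (auto simp: K_def mk_symmetric_def induce_subgraph_def)
    then show ?case using step by (cases "x \<in> T") auto
  qed
  ultimately obtain x y where xy: "x \<in> T" "y \<in> S - T" "(x, y) \<in> parcs K" using t by blast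
  then have "(x, y) \<notin> parcs G \<or> (y, x) \<notin> parcs G"
    by (auto simp: K_def mk_symmetric_def induce_subgraph_def complement_graph_def)
  then have "(x, y) \<notin> parcs G" by (meson parcs_sym)
  with xy(1,2) show ?thesis by (rule that)
qed

text \<open>
  Starting from \<open>{a}\<close>, where the collapse changes nothing, the collapsed set \<open>T\<close> grows inside \<open>S\<close>
  by one vertex \<open>b\<close> at a time. That \<open>b\<close> misses some \<open>s\<close> in \<open>T\<close> makes it non-adjacent to \<open>a\<close> in the
  collapsed graph, and each step contributes one more embedding.
\<close>
lemma mon_co_collapse:
  assumes G: "pair_graph G" and S: "S \<subseteq> pverts G" and conn: "anti_connected G S" and "a \<in> S"
  shows "\<exists>f. f \<in> mon (raag (co_collapse G a S)) (raag G)"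
proof -
  interpret pair_graph G by fact
  have finS: "finite S" using S pair_finite_verts by (rule finite_subset)
  have "\<exists>f. f \<in> mon (raag (co_collapse G a S)) (raag G)"
    if "a \<in> T" "T \<subseteq> S" "\<exists>f. f \<in> mon (raag (co_collapse G a T)) (raag G)" for T
    using that
  proof (induction "card (S - T)" arbitrary: T rule: less_induct)
    case less
    show ?case
    proof (cases "T = S")
      case True
      then show ?thesis using less.prems by simp
    next
      case False
      then have "T \<subset> S" "T \<noteq> {}" using less.prems by auto
      then obtain s b where sb: "s \<in> T" "b \<in> S - T" "(s, b) \<notin> parcs G"
        by (rule anti_connected_nonadjacent_pair[OF G conn])
      let ?H = "co_collapse G a T"
      interpret H: pair_graph ?H using G less.prems(1) by (rule pair_graph_co_collapse)
      have "(a, b) \<notin> parcs ?H" and ab: "a \<noteq> b"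
        using sb less.prems(1) by (auto simp: co_collapse_def fibre_def)
      moreover have "a \<in> pverts ?H" "b \<in> pverts ?H" using sb S by (auto simp: co_collapse_def)
      ultimately have "\<exists>f. f \<in> mon (raag (co_collapse ?H a {a, b})) (raag ?H)"
        by (intro H.mon_co_collapse_pair)
      moreover have "co_collapse ?H a {a, b} = co_collapse G a (insert b T)"
        using less.prems(1) sb S by (intro co_collapse_insert) auto
      ultimately have "\<exists>f. f \<in> mon (raag (co_collapse G a (insert b T))) (raag ?H)"
        by simp
      with less.prems(3) have "\<exists>f. f \<in> mon (raag (co_collapse G a (insert b T))) (raag G)"
        by (blast intro: mon_compose)
      moreover have "card (S - insert b T) < card (S - T)"
        using sb finS by (intro psubset_card_mono) auto
      ultimately show ?thesis using less sb by (intro less.hyps[of "insert b T"]) auto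
    qed
  qed
  moreover have "co_collapse G a {a} = G"
    using G S \<open>a \<in> S\<close> by (intro co_collapse_singleton) auto
  moreover have "id \<in> mon (raag G) (raag G)" by (simp add: mon_def hom_def)
  ultimately show ?thesis using \<open>a \<in> S\<close> by (metis empty_subsetI insert_subset singletonI)
qed

text \<open>
  Taking complements turns ``some vertex of \<open>S\<close> is non-adjacent to \<open>w\<close>'' into ``all vertices of \<open>S\<close>
  are adjacent to \<open>w\<close>'', which is adjacency in \<open>co_collapse\<close>.
\<close>
lemma parcs_co_contraction:
  assumes "S \<subseteq> pverts G" "a \<in> S" "pair_graph G"
  shows "(u, v) \<in> parcs (co_contraction G S) \<longleftrightarrow>
    u \<in> insert None (Some ` (pverts G - S)) \<and> v \<in> insert None (Some ` (pverts G - S)) \<and>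
    (case_option a id u, case_option a id v) \<in> parcs (co_collapse G a S)"
proof -
  interpret pair_graph G by fact
  show ?thesis using assms(1,2) pair_no_loops[of "(a, a)"] pair_no_loops[of "(x, x)" for x]
    by (cases u; cases v)
      (auto simp: co_contraction_def complement_graph_def contraction_def co_collapse_def fibre_def)
qed

theorem theorem2:
  fixes G :: "'a pair_pre_digraph" and S :: "'a set"
  assumes "pair_graph G"
    and "S \<subseteq> pverts G"
    and "anti_connected G S"
  shows "\<exists>f. f \<in> mon (raag (co_contraction G S)) (raag G)"
proof -
  have "S \<noteq> {}"
    using assms(3) by (auto simp: anti_connected_def connected_def strongly_connected_def
        mk_symmetric_def)
  then obtain a where a: "a \<in> S" by blast
  let ?H = "co_collapse G a S"
  let ?k = "\<lambda>x. if x = a then None else Some x"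
  have verts: "pverts (co_contraction G S) = insert None (Some ` (pverts G - S))"
    by (simp add: co_contraction_def complement_graph_def contraction_def)
  have "\<exists>f. f \<in> mon (raag (co_contraction G S)) (raag ?H)"
  proof (rule raag_iso_mon[where h = "case_option a id" and k = ?k])
    show "pair_graph (co_contraction G S)" using assms(1) by (rule pair_graph_co_contraction)
    show "pair_graph ?H" using assms(1) a by (rule pair_graph_co_collapse)
    show "(?k u, ?k v) \<in> parcs (co_contraction G S)" if "(u, v) \<in> parcs ?H" for u v
      using that a by (auto simp: parcs_co_contraction[OF assms(2) a assms(1)] co_collapse_def)
  qed (use a in \<open>auto simp: verts parcs_co_contraction[OF assms(2) a assms(1)] co_collapse_def\<close>)
  with mon_co_collapse[OF assms a] show ?thesis by (blast intro: mon_compose)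
qed

end
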